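(* For the code-capacity repetition-code decoder with clock period $q\ge2$ on $\mathbb Z$ there exists a constant $a\ge1$ such that the following holds. Suppose the initial error configuration is supported in a ball of radius $r\ge1$ centered at $x\in\mathbb Z$ and the initial message configuration is trivial. Then: 1. All defects are eliminated by time $t\le ar$. 2. For all $t\ge0$, the correction and syndrome configurations are supported in $B_{ar}(x)$.
   Context: Repetition code on $\mathbb Z$: one qubit and one parity check per site; the check at $x$ is $Z_xZ_{x+1}$, so an $X$ flip of qubit $x$ toggles the syndromes at $x-1$ and $x$. A defect is a site with syndrome $1$. $B_r(x)=\{y\in\mathbb Z:|x-y|\le r\}$. Decoder: each site $x$ at time $t\in\mathbb Z_{\ge0}$ has bits $e(x,t)$ (correction), $s(x,t)$ (syndrome), $m(x,t)$ (message) and a clock $c(x,t)\in\{0,\dots,q-1\}$, where $q\ge2$ is a fixed integer. At $t=0$: $e=0$, $m=0$, $c=0$ everywhere, and $s$ is the syndrome of the (finite) initial error configuration. All sites update synchronously from $t$ to $t+1$: - $c(x,t+1)=(c(x,t)+1)\bmod q$. - $e(x,t+1)=e(x,t)\oplus[s(x,t)=1\text{ and }m(x-1,t)=1]$ (a defect at $x$ with a message at $x-1$ moves one site to the left). - $s(\cdot,t+1)$ is $s(\cdot,t)$ updated according to the changes in $e$, i.e. it is the syndrome of the modulo-two sum of initial error and current correction. - $m(x,t+1)=1$ iff at least one of: (i) $s(x,t)=1$; (ii) $s(x+1,t)=1$ and $m(x,t)=1$; (iii) $s(x,t)=0$, $m(x,t)=0$, $c(x,t)=0$ and $m(x-1,t)=1$;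 (iv) $s(x,t)=0$, $m(x,t)=1$ and $m(x-1,t)=1$. Otherwise $m(x,t+1)=0$. *)

theory Defs
  imports Complex_Main
begin

text \<open>
  Qubits and checks are both indexed by \<^typ>\<open>int\<close>. Bits are Booleans, and addition modulo two is
  inequality: for Booleans, \<^term>\<open>a \<noteq> b\<close> is the exclusive or.
\<close>

definition supp :: "(int \<Rightarrow> bool) \<Rightarrow> int set" where
  "supp f = {y. f y}"

definition zball :: "int \<Rightarrow> real \<Rightarrow> int set" where
  "zball x r = {y. real_of_int \<bar>x - y\<bar> \<le> r}"

definition add2 :: "(int \<Rightarrow> bool) \<Rightarrow> (int \<Rightarrow> bool) \<Rightarrow> int \<Rightarrow> bool" where
  "add2 f g = (\<lambda>x. f x \<noteq> g x)"

text \<open>The check at \<open>x\<close> is the product of the Pauli \<open>Z\<close> operators of the qubits \<open>x\<close> and \<open>x + 1\<close>.\<close>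

definition syndrome :: "(int \<Rightarrow> bool) \<Rightarrow> int \<Rightarrow> bool" where
  "syndrome E = (\<lambda>x. E x \<noteq> E (x + 1))"

record config =
  corr :: "int \<Rightarrow> bool"
  synd :: "int \<Rightarrow> bool"
  msg :: "int \<Rightarrow> bool"
  clk :: "int \<Rightarrow> nat"

definition flips :: "config \<Rightarrow> int \<Rightarrow> bool" where
  "flips S = (\<lambda>x. synd S x \<and> msg S (x - 1))"

definition msg_step :: "config \<Rightarrow> int \<Rightarrow> bool" where
  "msg_step S = (\<lambda>x.
      synd S x
    \<or> (synd S (x + 1) \<and> msg S x)
    \<or> (\<not> synd S x \<and> \<not> msg S x \<and> clk S x = 0 \<and> msg S (x - 1))
    \<or> (\<not> synd S x \<and> msg S x \<and> msg S (x - 1)))"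

text \<open>
  The decoder sees only the syndrome, not the error, so the syndrome is updated by the changes of
  the correction; lemma \<open>synd_run\<close> below shows that it remains the syndrome of the sum of the
  initial error and the current correction.
\<close>

definition step :: "nat \<Rightarrow> config \<Rightarrow> config" where
  "step q S = \<lparr>
     corr = add2 (corr S) (flips S),
     synd = add2 (synd S) (syndrome (flips S)),
     msg = msg_step S,
     clk = (\<lambda>x. (clk S x + 1) mod q)\<rparr>"

definition init :: "(int \<Rightarrow> bool) \<Rightarrow> (int \<Rightarrow> bool) \<Rightarrow> config" where
  "init E M = \<lparr>corr = (\<lambda>_. False), synd = syndrome E, msg = M, clk = (\<lambda>_. 0)\<rparr>"

definition run :: "nat \<Rightarrow> (int \<Rightarrow> bool) \<Rightarrow> (int \<Rightarrow> bool) \<Rightarrow> nat \<Rightarrow> config" where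
  "run q E M t = (step q ^^ t) (init E M)"

lemma synd_run: "synd (run q E M t) = syndrome (add2 E (corr (run q E M t)))"
proof (induction t)
  case 0
  show ?case by (simp add: run_def init_def add2_def)
next
  case (Suc t)
  have eq: "run q E M (Suc t) = step q (run q E M t)" by (simp add: run_def)
  show ?case
    unfolding eq using Suc.IH by (auto simp: step_def add2_def syndrome_def fun_eq_iff)
qed

end

theory Submission
  imports Defs
begin

text \<open>
  Messages and defects never get to the left of the initial error, and defects never move right,
  so everything stays confined to the sites \<open>L, \<dots>, R\<close> around the initial error. The point of the
  message rule is that a defect is always followed by an uninterrupted block of messages: a block
  that starts at a defect is not eroded, it is extended to the left when the defect moves, and at
  its right end it grows by one site every \<open>q\<close> steps. Hence after \<open>q (R - L) + 1\<close> steps the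
  block of every surviving defect reaches \<open>R\<close>. From then on every defect except the leftmost one
  has a message on its left and moves left in each step. As a finite error never has exactly one
  defect, the rightmost defect is not the leftmost one; so the right end of the syndrome recedes at
  speed one, and all defects are gone after another \<open>R - L + 1\<close> steps.
\<close>

lemma run_Suc: "run q E M (Suc t) = step q (run q E M t)"
  by (simp add: run_def)

lemma clk_run: "clk (run q E M t) = (\<lambda>_. t mod q)"
  by (induction t) (auto simp: run_def init_def step_def mod_Suc_eq)

text \<open>Only an implication: if both alternatives hold, the resting and the arriving defect
  annihilate.\<close>

lemma synd_stepE:
  assumes "synd (step q S) x"
  obtains (stays) "synd S x" "\<not> msg S (x - 1)" | (moves) "synd S (x + 1)" "msg S x"
  using assms by (auto simp: step_def add2_def syndrome_def flips_def)

text \<open>Were \<open>y\<close> the only defect, \<open>F\<close> would be constant on either side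
  of it, hence zero on both by bounded support, and there would be no jump at
  \<open>y\<close>.\<close>

lemma ex_other_defect:
  assumes supp: "supp F \<subseteq> {L<..R}" and y: "syndrome F y"
  shows "\<exists>z. z \<noteq> y \<and> syndrome F z"
proof (rule ccontr)
  assume "\<not> ?thesis"
  then have eq: "F z = F (z + 1)" if "z \<noteq> y" for z
    using that by (auto simp: syndrome_def)
  have outside: "\<not> F z" if "z \<le> L \<or> z > R" for z
    using supp that by (force simp: supp_def)
  have "F z = F y" if "z \<le> y" for z
    using that
  proof (induction z rule: int_le_induct)
    case (step z)
    then show ?case using eq[of "z - 1"] by simp
  qed simp
  from this[of "min L y"] have left: "\<not> F y"
    using outside[of "min L y"] by simp
  have "F z = F (y + 1)" if "y + 1 \<le> z" for z
    using that
  proof (induction z rule: int_ge_induct)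
    case (step z)
    then show ?case using eq[of z] by simp
  qed simp
  from this[of "max (R + 1) (y + 1)"] have right: "\<not> F (y + 1)"
    using outside[of "max (R + 1) (y + 1)"] by (simp add: less_max_iff_disj)
  show False
    using y left right by (simp add: syndrome_def)
qed

text \<open>The interval gains its left endpoint because the check at \<open>L\<close> involves the
  qubit \<open>L + 1\<close>.\<close>

lemma supp_synd_run:
  assumes "supp E \<subseteq> {L<..R}" "supp (corr (run q E M t)) \<subseteq> {L<..R}"
  shows "supp (synd (run q E M t)) \<subseteq> {L..R}"
  using assms unfolding synd_run by (force simp: supp_def syndrome_def add2_def)

text \<open>The two bounds need a joint induction: a flip has a message on its left, so it lies
  right of \<open>L\<close>, while messages arise only at defects or from messages at the same site
  or its left neighbour.\<close>

lemma supp_corr_msg_run: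
  assumes E: "supp E \<subseteq> {L<..R}" and M: "supp M \<subseteq> {L..}"
  shows "supp (corr (run q E M t)) \<subseteq> {L<..R} \<and> supp (msg (run q E M t)) \<subseteq> {L..}"
proof (induction t)
  case 0
  show ?case using M by (simp add: run_def init_def supp_def)
next
  case (Suc t)
  let ?S = "run q E M t"
  have s: "L \<le> y \<and> y \<le> R" if "synd ?S y" for y
    using supp_synd_run[OF E conjunct1[OF Suc.IH]] that by (auto simp: supp_def)
  have m: "L \<le> y" if "msg ?S y" for y
    using Suc.IH that by (auto simp: supp_def)
  have c: "L < y \<and> y \<le> R" if "corr ?S y" for y
    using Suc.IH that by (auto simp: supp_def)
  have "L < y \<and> y \<le> R" if "flips ?S y" for y
    using that s[of y] m[of "y - 1"] by (auto simp: flips_def)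
  moreover have "L \<le> y" if "msg_step ?S y" for y
    using that s[of y] m[of y] m[of "y - 1"] by (auto simp: msg_step_def)
  ultimately show ?case
    using c by (auto simp: run_Suc step_def supp_def add2_def)
qed

text \<open>The front is measured from \<open>L\<close> instead of from the defect, so the bound
  does not depend on the history of the defect. Time starts at \<open>Suc n\<close> because an
  initial defect has no message yet.\<close>

lemma msg_behind_defect:
  assumes L: "\<And>t. supp (synd (run q E M t)) \<subseteq> {L..}"
    and s: "synd (run q E M (Suc n)) x"
  shows "msg (run q E M (Suc n)) x \<and>
    (\<forall>y. x \<le> y \<and> y \<le> L + int (n div q) \<longrightarrow> msg (run q E M (Suc n)) y)"
  using s
proof (induction n arbitrary: x)
  case 0
  have start: "run q E M (Suc 0) = step q (init E M)" "run q E M 0 = init E M"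
    by (simp_all add: run_def)
  have "L \<le> x"
    using L[of "Suc 0"] 0 by (auto simp: supp_def)
  moreover have "msg (run q E M (Suc 0)) x"
    using 0 unfolding start by (elim synd_stepE) (auto simp: step_def msg_step_def)
  ultimately show ?case by (auto dest: order_antisym)
next
  case (Suc n)
  let ?S = "run q E M (Suc n)"
  let ?F = "L + int (n div q)"
  have msg: "msg (run q E M (Suc (Suc n))) = msg_step ?S"
    by (simp add: run_Suc[of q E M "Suc n"] step_def)
  obtain d where d: "synd ?S d" "d = x \<or> d = x + 1 \<and> msg ?S x"
    using Suc.prems unfolding run_Suc[of q E M "Suc n"] by (elim synd_stepE) auto
  have x: "msg_step ?S x"
    using d by (auto simp: msg_step_def)
  have "msg_step ?S y" if y: "x \<le> y" "y \<le> L + int (Suc n div q)" for y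
  proof (cases "y \<le> d")
    case True
    then have "y = x \<or> y = d" using y d by auto
    then show ?thesis using x d by (auto simp: msg_step_def)
  next
    case False
    have "Suc n div q \<le> Suc (n div q)"
      by (simp add: div_Suc)
    then have "y - 1 \<le> ?F" using y by linarith
    then have prev: "msg ?S (y - 1)" using Suc.IH[OF d(1)] False by auto
    show ?thesis
    proof (cases "y \<le> ?F")
      case True
      then have "msg ?S y" using Suc.IH[OF d(1)] False by auto
      then show ?thesis using prev by (auto simp: msg_step_def)
    next
      case False
      \<comment> \<open>The quotient jumps exactly when the clock wraps to 0, which enables rule
        (iii).\<close>
      then have "Suc n div q \<noteq> n div q" using y by auto
      then have "clk ?S y = 0" by (auto simp: clk_run div_Suc split: if_splits)
      then show ?thesis using prev by (auto simp: msg_step_def)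
    qed
  qed
  then show ?case using x unfolding msg by blast
qed

lemma right_end_recedes:
  assumes E: "supp E \<subseteq> {L<..R}" and M: "supp M \<subseteq> {L..}" and q: "q > 0"
    and s: "synd (run q E M (Suc (q * nat (R - L)) + n)) y"
  shows "y \<le> R - int n"
  using s
proof (induction n arbitrary: y)
  case 0
  then show ?case
    using supp_synd_run[OF E conjunct1[OF supp_corr_msg_run[OF E M]]] by (force simp: supp_def)
next
  case (Suc n)
  let ?t = "q * nat (R - L) + n"
  let ?S = "run q E M (Suc ?t)"
  have confined: "supp (synd (run q E M t)) \<subseteq> {L..R}" for t
    using supp_synd_run[OF E conjunct1[OF supp_corr_msg_run[OF E M]]] .
  have IH: "z \<le> R - int n" if "synd ?S z" for z
    using Suc.IH that by simp
  have "synd (step q ?S) y"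
    using Suc.prems run_Suc[of q E M "Suc ?t"] by simp
  then show ?case
  proof (cases rule: synd_stepE)
    case moves
    then show ?thesis using IH[of "y + 1"] by simp
  next
    case stays
    show ?thesis
    proof (rule ccontr)
      assume "\<not> ?thesis"
      then have y: "y = R - int n" using IH[OF stays(1)] by simp
      have "supp (add2 E (corr ?S)) \<subseteq> {L<..R}"
        using E supp_corr_msg_run[OF E M, of q "Suc ?t"] by (auto simp: supp_def add2_def)
      then obtain z where z: "z \<noteq> y" "synd ?S z"
        using ex_other_defect[of "add2 E (corr ?S)"] stays(1) unfolding synd_run by blast
      have "z \<le> y - 1" using IH[OF z(2)] z(1) y by simp
      \<comment> \<open>The waiting time \<open>q * nat (R - L)\<close> has brought the front to
        \<open>R\<close> or beyond.\<close>
      moreover have "y - 1 \<le> L + int (?t div q)"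
        using y q by (simp add: div_add1_eq)
      moreover have "supp (synd (run q E M t)) \<subseteq> {L..}" for t
        using confined[of t] by auto
      ultimately have "msg ?S (y - 1)"
        using msg_behind_defect[OF _ z(2)] by blast
      then show False using stays(2) by simp
    qed
  qed
qed

theorem theorem4p6:
  fixes q :: nat
  assumes "q \<ge> 2"
  shows "\<exists>a::real. a \<ge> 1 \<and>
    (\<forall>(E :: int \<Rightarrow> bool) (M :: int \<Rightarrow> bool) (x :: int) (r :: real).
       r \<ge> 1 \<and> supp E \<subseteq> zball x r \<and> M = (\<lambda>_. False) \<longrightarrow>
         (\<exists>T::nat. real T \<le> a * r \<and> (\<forall>t\<ge>T. supp (synd (run q E M t)) = {})) \<and>
         (\<forall>t::nat. supp (corr (run q E M t)) \<subseteq> zball x (a * r) \<and>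
                   supp (synd (run q E M t)) \<subseteq> zball x (a * r)))"
\<comment> \<open>With N the floor of r, filling and receding take q(2N+1) + 2N+3 steps in total; as
  N \<le> r and 1 \<le> r, this is at most 3qr + 5r.\<close>
proof (intro exI[of _ "3 * real q + 5"] conjI allI impI)
  show "1 \<le> 3 * real q + 5" by simp
next
  fix E M :: "int \<Rightarrow> bool" and x :: int and r :: real
  assume "r \<ge> 1 \<and> supp E \<subseteq> zball x r \<and> M = (\<lambda>_. False)"
  then have r: "r \<ge> 1" and ball: "supp E \<subseteq> zball x r" and M0: "M = (\<lambda>_. False)" by auto
  define N where "N = nat \<lfloor>r\<rfloor>"
  define L where "L = x - int N - 1"
  define R where "R = x + int N"
  have N: "int N = \<lfloor>r\<rfloor>" "real N \<le> r"
    using r by (auto simp: N_def)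
  have width: "nat (R - L) = 2 * N + 1"
    by (simp add: L_def R_def)
  have E: "supp E \<subseteq> {L<..R}"
  proof
    fix y assume "y \<in> supp E"
    then have "\<bar>x - y\<bar> \<le> int N"
      using ball unfolding N(1) le_floor_iff by (auto simp: zball_def)
    then show "y \<in> {L<..R}" by (auto simp: L_def R_def)
  qed
  have M: "supp M \<subseteq> {L..}"
    by (simp add: M0 supp_def)
  have corr: "supp (corr (run q E M t)) \<subseteq> {L<..R}" for t
    using supp_corr_msg_run[OF E M] by blast
  note synd = supp_synd_run[OF E corr]
  have "real N + 1 \<le> (3 * real q + 5) * r"
  proof -
    have "real N + 1 \<le> 5 * r" using N r by linarith
    also have "\<dots> \<le> (3 * real q + 5) * r" using r by (intro mult_right_mono) auto
    finally show ?thesis .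
  qed
  moreover have "real_of_int \<bar>x - y\<bar> \<le> real N + 1" if "y \<in> {L..R}" for y
    using that by (auto simp: L_def R_def)
  ultimately have interval: "{L..R} \<subseteq> zball x ((3 * real q + 5) * r)"
    by (force simp: zball_def)
  show "supp (corr (run q E M t)) \<subseteq> zball x ((3 * real q + 5) * r)"
       "supp (synd (run q E M t)) \<subseteq> zball x ((3 * real q + 5) * r)" for t
    using corr[of t] synd[of t] interval by force+
  let ?fill = "Suc (q * nat (R - L))"
  \<comment> \<open>Since \<open>R - L = 2 * N + 1\<close>, after \<open>2 * N + 2\<close> further
    steps the right bound drops below \<open>L\<close>.\<close>
  let ?stop = "?fill + (2 * N + 2)"
  show "\<exists>T::nat. real T \<le> (3 * real q + 5) * r \<and> (\<forall>t\<ge>T. supp (synd (run q E M t)) = {})"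
  proof (intro exI[of _ ?stop] conjI allI impI)
    have "real q * (2 * real N + 1) \<le> real q * (3 * r)"
      using N r by (intro mult_left_mono) auto
    moreover have "2 * real N + 3 \<le> 5 * r" using N r by linarith
    ultimately show "real ?stop \<le> (3 * real q + 5) * r"
      unfolding width by (simp add: algebra_simps)
  next
    fix t assume t: "?stop \<le> t"
    define n where "n = t - ?fill"
    have tn: "t = ?fill + n" and n: "n \<ge> 2 * N + 2" using t by (auto simp: n_def)
    have False if y: "synd (run q E M t) y" for y
    proof -
      have "y \<le> R - int n"
        using right_end_recedes[OF E M _ y[unfolded tn]] assms by simp
      moreover have "L \<le> y" using synd[of t] y by (auto simp: supp_def)
      ultimately show False using n by (simp add: L_def R_def)
    qed
    then show "supp (synd (run q E M t)) = {}" by (auto simp: supp_def)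
  qed
qed

end
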